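(* Let $Y=\prod_{i=1}^\infty N(\mathbf{x}_i)$ be a right-infinite curl. Let $I=\{i_1<i_2<\dots<i_k\}$ and $J=\{j_1<j_2<\dots<j_k\}$ be two sequences of integers such that $i_t\le j_t$ for each $t$. Define the skew shape $$\lambda=\lambda(I,J)=(j_k,j_{k-1}+1,\dots,j_1+k-1)/(i_k,i_{k-1}+1,\dots,i_1+k-1).$$ Then $$\Delta_{I,J}(Y)=\det\big(h^{(i_s)}_{j_t-i_s}(\mathbf{x})\big)_{s,t=1}^k=s_\lambda(\mathbf{x}).$$
   Context: Fix $n\ge1$. For nonnegative reals $a_1,\dots,a_n$, the curl $N(a_1,\dots,a_n)$ is the doubly infinite matrix (rows and columns indexed by $\mathbb{Z}$) that is upper triangular with $1$'s on the diagonal and $(i,j)$ entry $a_ia_{i+1}\cdots a_{j-1}$ for $i<j$ (indices modulo $n$). Let $\mathbf{x}_i=(x_i^{(1)},\dots,x_i^{(n)})$, $i=1,2,\dots$, be $n$-tuples of nonnegative reals with $\sum_{i,j}x_i^{(j)}<\infty$; upper indices are read modulo $n$. The right-infinite curl $\prod_{i=1}^\infty N(\mathbf{x}_i)$ is the entrywise limit of $N(\mathbf{x}_1)\cdots N(\mathbf{x}_m)$ as $m\to\infty$ (which exists). $\Delta_{I,J}(Y)$ is the minor of $Y$ with row set $I$ and column set $J$. Loop homogeneous symmetric functions: for $r\ge1$ and $k\in\mathbb{Z}/n\mathbb{Z}$, $h_r^{(k)}(\mathbf{x})=\sum x_{i_1}^{(k)}x_{i_2}^{(k+1)}\cdots x_{i_r}^{(k+r-1)}$,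 summed over all weakly increasing sequences $1\le i_1\le i_2\le\dots\le i_r$; also $h_0^{(k)}=1$ and $h_r^{(k)}=0$ for $r<0$. A skew shape $(\rho_1,\dots,\rho_k)/(\nu_1,\dots,\nu_k)$ consists of the squares in row $r$ (rows numbered from the top) and columns $c$ with $\nu_r<c\le\rho_r$, for $r=1,\dots,k$. A square $s$ in row $r$ and column $c$ has residue $r(s)=c-r$ modulo $n$. A semistandard Young tableau $T$ of shape $\lambda$ is a filling of each square $s$ by a positive integer $T(s)$, weakly increasing along rows and strictly increasing down columns; its weight is $x^T=\prod_{s\in\lambda}x_{T(s)}^{(r(s))}$. The loop Schur function is $s_\lambda(\mathbf{x})=\sum_Tx^T$, summed over all semistandard Young tableaux of shape $\lambda$. *)

theory Defs
  imports
    Complex_Main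
    "HOL-Library.FuncSet"
    "HOL-Analysis.Infinite_Sum"
    "Jordan_Normal_Form.Determinant"
begin

text \<open>An \<open>n\<close>-tuple is a function on \<open>{1..n}\<close>; \<open>cyc n a k\<close> is its entry at the representative of
  \<open>k\<close> modulo \<open>n\<close> that lies in \<open>{1..n}\<close>.\<close>

definition cyc :: "nat \<Rightarrow> (nat \<Rightarrow> real) \<Rightarrow> int \<Rightarrow> real" where
  "cyc n a k = a (nat ((k - 1) mod int n) + 1)"

definition curl :: "nat \<Rightarrow> (nat \<Rightarrow> real) \<Rightarrow> int \<Rightarrow> int \<Rightarrow> real" where
  "curl n a i j =
     (if i < j then (\<Prod>k\<in>{i..<j}. cyc n a k) else if i = j then 1 else 0)"

text \<open>Doubly infinite matrices are functions of two integers. For upper triangular factors, the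
  only ones used here, each entry of the product is a sum with finitely many nonzero terms.\<close>

definition zmat_one :: "int \<Rightarrow> int \<Rightarrow> real" where
  "zmat_one i j = (if i = j then 1 else 0)"

definition zmat_mult ::
    "(int \<Rightarrow> int \<Rightarrow> real) \<Rightarrow> (int \<Rightarrow> int \<Rightarrow> real) \<Rightarrow> int \<Rightarrow> int \<Rightarrow> real" where
  "zmat_mult A B i j = (\<Sum>\<^sub>\<infinity>l\<in>UNIV. A i l * B l j)"

primrec curl_prod :: "nat \<Rightarrow> (nat \<Rightarrow> nat \<Rightarrow> real) \<Rightarrow> nat \<Rightarrow> int \<Rightarrow> int \<Rightarrow> real" where
  "curl_prod n x 0 = zmat_one"
| "curl_prod n x (Suc m) = zmat_mult (curl_prod n x m) (curl n (x (Suc m)))"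

definition right_infinite_curl :: "nat \<Rightarrow> (nat \<Rightarrow> nat \<Rightarrow> real) \<Rightarrow> int \<Rightarrow> int \<Rightarrow> real" where
  "right_infinite_curl n x i j = lim (\<lambda>m. curl_prod n x m i j)"

text \<open>Rows and columns of a minor are taken in increasing order; the index sets are meant to be
  finite and of equal size.\<close>

definition minor :: "int set \<Rightarrow> int set \<Rightarrow> (int \<Rightarrow> int \<Rightarrow> real) \<Rightarrow> real" where
  "minor I J Y =
     det (mat (card I) (card J) (\<lambda>(s, t). Y (sorted_list_of_set I ! s) (sorted_list_of_set J ! t)))"

text \<open>In \<open>loop_h n x k r\<close>, \<open>k\<close> is the upper and \<open>r\<close> the lower index. The list
  \<open>is = [i\<^sub>1, \<dots>, i\<^sub>r]\<close> is indexed from 0, so position \<open>p\<close> carries the upper index \<open>k + p\<close>.\<close>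

definition loop_h :: "nat \<Rightarrow> (nat \<Rightarrow> nat \<Rightarrow> real) \<Rightarrow> int \<Rightarrow> int \<Rightarrow> real" where
  "loop_h n x k r =
     (if r < 0 then 0
      else (\<Sum>\<^sub>\<infinity>is\<in>{is. length is = nat r \<and> sorted is \<and> set is \<subseteq> {1..}}.
              \<Prod>p<nat r. cyc n (x (is ! p)) (k + int p)))"

text \<open>A square is a pair (row, column); only \<open>\<rho> r\<close> and \<open>\<nu> r\<close> with \<open>1 \<le> r \<le> k\<close> matter.\<close>

definition skew_shape :: "nat \<Rightarrow> (nat \<Rightarrow> int) \<Rightarrow> (nat \<Rightarrow> int) \<Rightarrow> (nat \<times> int) set" where
  "skew_shape k \<rho> \<nu> = {(r, c). 1 \<le> r \<and> r \<le> k \<and> \<nu> r < c \<and> c \<le> \<rho> r}"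

text \<open>Fillings are extensional functions, so that each tableau is counted once.\<close>

definition ssyt :: "(nat \<times> int) set \<Rightarrow> (nat \<times> int \<Rightarrow> nat) set" where
  "ssyt S = {T \<in> S \<rightarrow>\<^sub>E {1..}.
     (\<forall>r c c'. (r, c) \<in> S \<longrightarrow> (r, c') \<in> S \<longrightarrow> c < c' \<longrightarrow> T (r, c) \<le> T (r, c')) \<and>
     (\<forall>r r' c. (r, c) \<in> S \<longrightarrow> (r', c) \<in> S \<longrightarrow> r < r' \<longrightarrow> T (r, c) < T (r', c))}"

definition loop_schur :: "nat \<Rightarrow> (nat \<Rightarrow> nat \<Rightarrow> real) \<Rightarrow> (nat \<times> int) set \<Rightarrow> real" where
  "loop_schur n x S =
     (\<Sum>\<^sub>\<infinity>T\<in>ssyt S. \<Prod>(r, c)\<in>S. cyc n (x (T (r, c))) (c - int r))"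

text \<open>Row \<open>r\<close> of \<open>\<lambda>(I, J)\<close> is \<open>(j\<^bsub>k+1-r\<^esub> + r - 1) / (i\<^bsub>k+1-r\<^esub> + r - 1)\<close>.\<close>

definition shape_of :: "nat \<Rightarrow> (nat \<Rightarrow> int) \<Rightarrow> (nat \<Rightarrow> int) \<Rightarrow> (nat \<times> int) set" where
  "shape_of k i j =
     skew_shape k (\<lambda>r. j (k + 1 - r) + int r - 1) (\<lambda>r. i (k + 1 - r) + int r - 1)"

end

theory Submission
  imports Defs
begin

text \<open>
  The argument first keeps only the variables \<open>x 1, \<dots>, x m\<close>, that is, the finite product
  \<open>Y\<^sub>m = curl_prod n x m\<close>, and compares two recursions in \<open>m\<close>.

  On the side of matrices, let \<open>N\<close> be the curl of \<open>x (m + 1)\<close>. Since \<open>N l j = N l q * N q j\<close> for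
  \<open>l \<le> q \<le> j\<close>, column \<open>j\<close> of \<open>Y\<^sub>m N\<close> minus \<open>N q j\<close> times its column \<open>q\<close> is the combination of the
  columns \<open>l\<close> of \<open>Y\<^sub>m\<close> with \<open>q < l \<le> j\<close> and coefficients \<open>N l j\<close> (\<open>curl_prod_Suc_split\<close>).
  Applying this to consecutive columns \<open>j (t - 1)\<close> and \<open>j t\<close> of a minor and expanding by
  multilinearity gives a Pieri rule (\<open>det_curl_prod_Suc\<close>): the minor of \<open>Y\<^sub>m N\<close> with columns \<open>j\<close>
  is the sum, over all \<open>L\<close> with \<open>j (t - 1) < L t \<le> j t\<close>, of the minor of \<open>Y\<^sub>m\<close> with columns \<open>L\<close>
  weighted by the product of the \<open>N (L t) (j t)\<close>.

  On the side of tableaux with entries at most \<open>m + 1\<close>, the boxes with entry at most \<open>m\<close> fill a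
  shape \<open>\<lambda>(I, L)\<close>, and the boxes with entry \<open>m + 1\<close> have weight equal to the same product.
  That no column contains \<open>m + 1\<close> twice amounts to the same inequalities
  \<open>j (t - 1) < L t\<close> (\<open>bij_betw_extend_filling\<close>). For \<open>m = 0\<close> both sides say whether \<open>i = j\<close>,
  so minors of \<open>Y\<^sub>m\<close> are truncated loop Schur functions (\<open>det_curl_prod_eq_tableau_sum\<close>);
  there are no signs to cancel.

  For single entries the step from column \<open>j - 1\<close> to column \<open>j\<close> is the recursion that removes
  a last letter \<open>m + 1\<close> from a weakly increasing list, which makes them truncations of
  \<open>loop_h\<close>. They increase with \<open>m\<close> and are bounded by powers of the sum of all variables, so they
  converge; the determinants follow by continuity. All weights being nonnegative, the limits of
  the truncated sums are the infinite sums over lists and over tableaux (\<open>has_sum_exhaustion\<close>).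
\<close>

section \<open>Multiplication by one curl\<close>

lemma curl_mult:
  assumes "l \<le> q" "q \<le> j"
  shows "curl n a l j = curl n a l q * curl n a q j"
proof -
  have *: "curl n a u v = (\<Prod>k\<in>{u..<v}. cyc n a k)" if "u \<le> v" for u v
    using that by (auto simp: curl_def)
  have "{l..<j} = {l..<q} \<union> {q..<j}" using assms by auto
  then have "(\<Prod>k\<in>{l..<j}. cyc n a k) = (\<Prod>k\<in>{l..<q}. cyc n a k) * (\<Prod>k\<in>{q..<j}. cyc n a k)"
    by (simp add: prod.union_disjoint)
  then show ?thesis using assms by (simp add: *)
qed

lemma zmat_mult_curl_eq_sum:
  assumes "\<And>i j. j < i \<Longrightarrow> A i j = 0" and "q \<le> i"
  shows "zmat_mult A (curl n a) i j = (\<Sum>l\<in>{q..j}. A i l * curl n a l j)"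
proof -
  have "zmat_mult A (curl n a) i j = (\<Sum>\<^sub>\<infinity>l\<in>{q..j}. A i l * curl n a l j)"
    unfolding zmat_mult_def
    by (rule infsum_cong_neutral) (use assms in \<open>auto simp: curl_def\<close>)
  then show ?thesis by simp
qed

text \<open>Factoring \<open>N l j = N l q * N q j\<close> in the terms with \<open>l \<le> q\<close> makes them a multiple of the
  entry in column \<open>q\<close> of the product. This is what lets one column of a minor be
  reduced by the previous one.\<close>

lemma zmat_mult_curl_split:
  assumes A: "\<And>i j. j < i \<Longrightarrow> A i j = 0" and "q \<le> j"
  shows "zmat_mult A (curl n a) i j
           = (\<Sum>l\<in>{q + 1..j}. A i l * curl n a l j) + curl n a q j * zmat_mult A (curl n a) i q"
proof -
  define b where "b = min i q"
  have b: "b \<le> i" "b \<le> q" by (auto simp: b_def)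
  have "{b..j} = {b..q} \<union> {q + 1..j}" using b assms(2) by auto
  then have "zmat_mult A (curl n a) i j
      = (\<Sum>l\<in>{b..q}. A i l * curl n a l j) + (\<Sum>l\<in>{q + 1..j}. A i l * curl n a l j)"
    using zmat_mult_curl_eq_sum[OF A b(1)] by (simp add: sum.union_disjoint)
  also have "(\<Sum>l\<in>{b..q}. A i l * curl n a l j)
      = (\<Sum>l\<in>{b..q}. curl n a q j * (A i l * curl n a l q))"
  proof (rule sum.cong)
    fix l assume "l \<in> {b..q}"
    then have "curl n a l j = curl n a l q * curl n a q j"
      using assms(2) by (intro curl_mult) auto
    then show "A i l * curl n a l j = curl n a q j * (A i l * curl n a l q)" by simp
  qed simp
  also have "\<dots> = curl n a q j * zmat_mult A (curl n a) i q"
    using zmat_mult_curl_eq_sum[OF A b(1)] by (simp add: sum_distrib_left)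
  finally show ?thesis by simp
qed

lemma curl_prod_below_diagonal: "j < i \<Longrightarrow> curl_prod n x m i j = 0"
proof (induction m arbitrary: i j)
  case 0
  then show ?case by (simp add: zmat_one_def)
next
  case (Suc m)
  then show ?case
    using zmat_mult_curl_eq_sum[of "curl_prod n x m" i i n "x (Suc m)" j] by simp
qed

lemma curl_prod_Suc_split:
  "q \<le> j \<Longrightarrow> curl_prod n x (Suc m) i j
     = (\<Sum>l\<in>{q + 1..j}. curl_prod n x m i l * curl n (x (Suc m)) l j)
       + curl n (x (Suc m)) q j * curl_prod n x (Suc m) i q"
  unfolding curl_prod.simps
  by (rule zmat_mult_curl_split) (auto simp: curl_prod_below_diagonal)

lemma curl_prod_Suc_recursion:
  "curl_prod n x (Suc m) i j
     = curl_prod n x m i j + cyc n (x (Suc m)) (j - 1) * curl_prod n x (Suc m) i (j - 1)"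
proof -
  have "{j - 1..<j} = {j - 1}" by auto
  then have "curl n (x (Suc m)) (j - 1) j = cyc n (x (Suc m)) (j - 1)" by (simp add: curl_def)
  moreover have "curl n (x (Suc m)) j j = 1" by (simp add: curl_def)
  ultimately show ?thesis using curl_prod_Suc_split[of "j - 1" j n x m i] by simp
qed

section \<open>Minors and the Pieri rule for curls\<close>

lemma det_mat_columns_sum:
  fixes A :: "nat \<Rightarrow> 'b \<Rightarrow> 'a::comm_ring_1"
  assumes "\<And>t. t \<in> {1..k} \<Longrightarrow> finite (R t)"
  shows "det (mat k k (\<lambda>(s, t). \<Sum>l\<in>R (t + 1). w (t + 1) l * A s l))
    = (\<Sum>L\<in>(\<Pi>\<^sub>E t\<in>{1..k}. R t). (\<Prod>t\<in>{1..k}. w t (L t)) * det (mat k k (\<lambda>(s, t). A s (L (t + 1)))))"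
proof -
  let ?P = "{p. p permutes {0..<k}}"
  have shift: "(\<Prod>t<k. g (t + 1)) = (\<Prod>t\<in>{1..k}. g t)" for g :: "nat \<Rightarrow> 'a"
    by (simp add: prod.atLeast1_atMost_eq)
  have det: "det (mat k k (\<lambda>(s, t). B s (t + 1)))
      = (\<Sum>p\<in>?P. signof p * (\<Prod>t\<in>{1..k}. B (p (t - 1)) t))" for B :: "nat \<Rightarrow> nat \<Rightarrow> 'a"
  proof -
    have "p permutes {0..<k} \<Longrightarrow> t < k \<Longrightarrow> p t < k" for p t
      by simp
    then have "det (mat k k (\<lambda>(s, t). B s (t + 1)))
        = (\<Sum>p\<in>?P. signof p * (\<Prod>t<k. B (p t) (t + 1)))"
      by (subst det_col[of _ k]) (auto intro!: sum.cong prod.cong)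
    also have "\<dots> = (\<Sum>p\<in>?P. signof p * (\<Prod>t\<in>{1..k}. B (p (t - 1)) t))"
      by (subst shift[symmetric]) simp
    finally show ?thesis .
  qed
  have "det (mat k k (\<lambda>(s, t). \<Sum>l\<in>R (t + 1). w (t + 1) l * A s l))
      = (\<Sum>p\<in>?P. signof p * (\<Prod>t\<in>{1..k}. \<Sum>l\<in>R t. w t l * A (p (t - 1)) l))"
    by (rule det)
  also have "\<dots> = (\<Sum>p\<in>?P. signof p *
      (\<Sum>L\<in>(\<Pi>\<^sub>E t\<in>{1..k}. R t). \<Prod>t\<in>{1..k}. w t (L t) * A (p (t - 1)) (L t)))"
    using assms by (subst prod_sum_PiE) auto
  also have "\<dots> = (\<Sum>L\<in>(\<Pi>\<^sub>E t\<in>{1..k}. R t). \<Sum>p\<in>?P. (\<Prod>t\<in>{1..k}. w t (L t)) *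
      (signof p * (\<Prod>t\<in>{1..k}. A (p (t - 1)) (L t))))"
    unfolding sum_distrib_left by (subst sum.swap) (simp add: prod.distrib ac_simps)
  also have "\<dots> = (\<Sum>L\<in>(\<Pi>\<^sub>E t\<in>{1..k}. R t). (\<Prod>t\<in>{1..k}. w t (L t)) *
      det (mat k k (\<lambda>(s, t). A s (L (t + 1)))))"
  proof -
    have "det (mat k k (\<lambda>(s, t). A s (L (t + 1))))
        = (\<Sum>p\<in>?P. signof p * (\<Prod>t\<in>{1..k}. A (p (t - 1)) (L t)))" for L
      by (rule det[of "\<lambda>s t. A s (L t)"])
    then show ?thesis by (simp only: sum_distrib_left)
  qed
  finally show ?thesis .
qed

lemma det_subtract_previous_columns:
  fixes B :: "nat \<Rightarrow> nat \<Rightarrow> 'a::idom"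
  shows "det (mat k k (\<lambda>(s, t). if t = 0 then B s t else B s t - c t * B s (t - 1)))
           = det (mat k k (\<lambda>(s, t). B s t))"
proof -
  \<comment> \<open>Performing all subtractions at once is multiplication by a unipotent bidiagonal matrix.\<close>
  define U where "U = mat k k (\<lambda>(r, t). if r = t then 1 else if r + 1 = t then - c t else 0)"
  have U: "U \<in> carrier_mat k k" by (simp add: U_def)
  have "det U = prod_list (diag_mat U)"
    by (rule det_upper_triangular[OF _ U]) (auto simp: U_def upper_triangular_def)
  also have "\<dots> = 1"
    unfolding prod_list_diag_prod by (auto simp: U_def)
  finally have "det U = 1" .
  moreover have "mat k k (\<lambda>(s, t). B s t) * U
      = mat k k (\<lambda>(s, t). if t = 0 then B s t else B s t - c t * B s (t - 1))" (is "?L = ?R")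
  proof (rule eq_matI)
    fix s t assume "s < dim_row ?R" "t < dim_col ?R"
    then have st: "s < k" "t < k" by auto
    have "?L $$ (s, t) = (\<Sum>r\<in>{0..<k}. B s r * (if r = t then 1 else if r + 1 = t then - c t else 0))"
      using st by (auto simp: U_def scalar_prod_def intro!: sum.cong)
    also have "\<dots> = (\<Sum>r\<in>{t - 1, t}. B s r * (if r = t then 1 else if r + 1 = t then - c t else 0))"
      using st by (intro sum.mono_neutral_right) auto
    also have "\<dots> = ?R $$ (s, t)"
      using st by (cases t) auto
    finally show "?L $$ (s, t) = ?R $$ (s, t)" .
  qed (auto simp: U_def)
  ultimately show ?thesis
    using det_mult[of "mat k k (\<lambda>(s, t). B s t)" k U] U by simp
qed

lemma det_mat_row_zero:
  assumes "s < k" and "\<And>t. t < k \<Longrightarrow> B s t = (0::'a::comm_ring_1)"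
  shows "det (mat k k (\<lambda>(s, t). B s t)) = 0"
proof -
  have "(\<Prod>r = 0..<k. mat k k (\<lambda>(s, t). B s t) $$ (r, p r)) = 0" if "p permutes {0..<k}" for p
  proof (rule prod_zero)
    have "p s < k" using that assms(1) by simp
    then show "\<exists>r\<in>{0..<k}. mat k k (\<lambda>(s, t). B s t) $$ (r, p r) = 0"
      using assms by (intro bexI[of _ s]) auto
  qed simp
  then show ?thesis by (subst det_def'[of _ k]) auto
qed

lemma tendsto_det_mat:
  fixes B :: "nat \<Rightarrow> nat \<Rightarrow> nat \<Rightarrow> real"
  assumes "\<And>s t. s < k \<Longrightarrow> t < k \<Longrightarrow> (\<lambda>m. B m s t) \<longlonglongrightarrow> C s t"
  shows "(\<lambda>m. det (mat k k (\<lambda>(s, t). B m s t))) \<longlonglongrightarrow> det (mat k k (\<lambda>(s, t). C s t))"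
proof -
  have "det (mat k k (\<lambda>(s, t). D s t))
      = (\<Sum>p | p permutes {0..<k}. signof p * (\<Prod>s = 0..<k. D s (p s)))" for D :: "nat \<Rightarrow> nat \<Rightarrow> real"
    by (subst det_def'[of _ k]) (auto intro!: sum.cong prod.cong)
  moreover have "p permutes {0..<k} \<Longrightarrow> s < k \<Longrightarrow> p s < k" for p s
    by simp
  ultimately show ?thesis
    by (auto intro!: tendsto_sum tendsto_mult tendsto_prod assms)
qed

lemma sorted_list_of_set_strict_mono_image:
  fixes i :: "nat \<Rightarrow> int"
  assumes "strict_mono_on {1..k} i"
  shows "sorted_list_of_set (i ` {1..k}) = map (\<lambda>s. i (s + 1)) [0..<k]"
proof (rule strict_sorted_equal)
  show "sorted_wrt (<) (map (\<lambda>s. i (s + 1)) [0..<k])"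
    using assms by (auto simp: sorted_wrt_iff_nth_less intro!: strict_mono_onD[OF assms])
  have "{1..k} = (\<lambda>s. s + 1) ` {0..<k}"
    by (simp add: atLeastLessThanSuc_atLeastAtMost)
  then have "i ` {1..k} = (\<lambda>s. i (s + 1)) ` {0..<k}"
    by (simp only: image_image)
  then show "set (sorted_list_of_set (i ` {1..k})) = set (map (\<lambda>s. i (s + 1)) [0..<k])"
    by simp
qed auto

lemma minor_strict_mono_image:
  assumes "strict_mono_on {1..k} i" "strict_mono_on {1..k} j"
  shows "minor (i ` {1..k}) (j ` {1..k}) Y = det (mat k k (\<lambda>(s, t). Y (i (s + 1)) (j (t + 1))))"
proof -
  have card: "card (f ` {1..k}) = k" if "strict_mono_on {1..k} f" for f :: "nat \<Rightarrow> int"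
    using that by (simp add: card_image strict_mono_on_imp_inj_on)
  show ?thesis
    unfolding minor_def card[OF assms(1)] card[OF assms(2)]
      sorted_list_of_set_strict_mono_image[OF assms(1)]
      sorted_list_of_set_strict_mono_image[OF assms(2)]
    by (intro arg_cong[where f = det] cong_mat) auto
qed

text \<open>Strictly increasing index functions that differ have different images, and then some row
  \<open>i s\<close> meets no column.\<close>

lemma det_zmat_one:
  assumes i: "strict_mono_on {1..k} i" and j: "strict_mono_on {1..k} j"
  shows "det (mat k k (\<lambda>(s, t). zmat_one (i (s + 1)) (j (t + 1))))
           = (if \<forall>t\<in>{1..k}. i t = j t then 1 else 0)"
proof (cases "i ` {1..k} \<subseteq> j ` {1..k}")
  case True
  have "card (f ` {1..k}) = k" if "strict_mono_on {1..k} f" for f :: "nat \<Rightarrow> int"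
    using that by (simp add: card_image strict_mono_on_imp_inj_on)
  then have "i ` {1..k} = j ` {1..k}"
    using True i j by (intro card_subset_eq) auto
  then have "map (\<lambda>s. i (s + 1)) [0..<k] = map (\<lambda>s. j (s + 1)) [0..<k]"
    using sorted_list_of_set_strict_mono_image i j by metis
  then have *: "i (s + 1) = j (s + 1)" if "s < k" for s
    using that by (simp add: map_eq_conv)
  then have eq: "i t = j t" if "t \<in> {1..k}" for t
    using that *[of "t - 1"] by auto
  have "mat k k (\<lambda>(s, t). zmat_one (i (s + 1)) (j (t + 1))) = 1\<^sub>m k"
    using * strict_mono_on_imp_inj_on[OF j]
    by (auto simp: zmat_one_def one_mat_def inj_on_eq_iff)
  then show ?thesis using eq by simp
next
  case False
  then obtain s where s: "s \<in> {1..k}" "i s \<notin> j ` {1..k}" by blast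
  have "det (mat k k (\<lambda>(s, t). zmat_one (i (s + 1)) (j (t + 1)))) = 0"
  proof (rule det_mat_row_zero)
    show "s - 1 < k" using s by auto
    fix t assume "t < k"
    then have "j (t + 1) \<in> j ` {1..k}" by auto
    then show "zmat_one (i (s - 1 + 1)) (j (t + 1)) = 0"
      using s by (auto simp: zmat_one_def)
  qed
  moreover have "\<not> (\<forall>t\<in>{1..k}. i t = j t)" using s by auto
  ultimately show ?thesis by simp
qed

text \<open>The positions for the \<open>t\<close>-th new column index. No column index precedes \<open>j 1\<close>; there
  the lower end \<open>i 1\<close> serves, as the columns further left vanish on the rows \<open>i 1 < i 2 < \<dots>\<close> of
  an upper triangular matrix.\<close>

definition interlacing_range :: "(nat \<Rightarrow> int) \<Rightarrow> (nat \<Rightarrow> int) \<Rightarrow> nat \<Rightarrow> int set" where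
  "interlacing_range i j t = {(if t = 1 then i 1 else j (t - 1) + 1)..j t}"

text \<open>The sum has only \<open>L\<close> that interlace with \<open>j\<close>, and hence no cancellation, because the columns
  of the minor are reduced before it is expanded by multilinearity.\<close>

lemma det_curl_prod_Suc:
  assumes i: "strict_mono_on {1..k} i" and j: "strict_mono_on {1..k} j"
  shows "det (mat k k (\<lambda>(s, t). curl_prod n x (Suc m) (i (s + 1)) (j (t + 1))))
    = (\<Sum>L\<in>(\<Pi>\<^sub>E t\<in>{1..k}. interlacing_range i j t). (\<Prod>t\<in>{1..k}. curl n (x (Suc m)) (L t) (j t)) *
         det (mat k k (\<lambda>(s, t). curl_prod n x m (i (s + 1)) (L (t + 1)))))"
proof -
  let ?N = "curl n (x (Suc m))" and ?Y = "curl_prod n x (Suc m)" and ?A = "curl_prod n x m"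
  let ?B = "\<lambda>s t. ?Y (i (s + 1)) (j (t + 1))"
  have "det (mat k k (\<lambda>(s, t). ?B s t))
      = det (mat k k (\<lambda>(s, t). if t = 0 then ?B s t else ?B s t - ?N (j t) (j (t + 1)) * ?B s (t - 1)))"
    by (rule det_subtract_previous_columns[symmetric])
  also have "\<dots> = det (mat k k (\<lambda>(s, t). \<Sum>l\<in>interlacing_range i j (t + 1).
      ?N l (j (t + 1)) * ?A (i (s + 1)) l))"
  proof (rule arg_cong[where f = det], rule cong_mat[OF refl refl], unfold case_prod_conv)
    fix s t assume st: "s < k" "t < k"
    show "(if t = 0 then ?B s t else ?B s t - ?N (j t) (j (t + 1)) * ?B s (t - 1))
            = (\<Sum>l\<in>interlacing_range i j (t + 1). ?N l (j (t + 1)) * ?A (i (s + 1)) l)"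
    proof (cases "t = 0")
      case True
      have "i 1 \<le> i (s + 1)"
        using st by (intro strict_mono_on_leD[OF i]) auto
      then show ?thesis
        using True zmat_mult_curl_eq_sum[of ?A "i 1" "i (s + 1)"]
        by (simp add: interlacing_range_def curl_prod_below_diagonal mult.commute)
    next
      case False
      then have "j t \<le> j (t + 1)"
        using st by (intro strict_mono_on_leD[OF j]) auto
      then show ?thesis
        using False curl_prod_Suc_split[of "j t" "j (t + 1)" n x m "i (s + 1)"]
        by (simp add: interlacing_range_def mult.commute del: curl_prod.simps)
    qed
  qed
  also have "\<dots> = (\<Sum>L\<in>(\<Pi>\<^sub>E t\<in>{1..k}. interlacing_range i j t). (\<Prod>t\<in>{1..k}. ?N (L t) (j t)) *
         det (mat k k (\<lambda>(s, t). ?A (i (s + 1)) (L (t + 1)))))"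
    by (rule det_mat_columns_sum) (simp add: interlacing_range_def)
  finally show ?thesis .
qed

section \<open>Tableaux with bounded entries\<close>

lemma mem_shape_of:
  "(r, c) \<in> shape_of k i j \<longleftrightarrow>
     r \<in> {1..k} \<and> i (k + 1 - r) \<le> c - int r \<and> c - int r < j (k + 1 - r)"
  by (auto simp: shape_of_def skew_shape_def)

text \<open>Coordinates adapted to minors: \<open>t\<close> numbers the rows from the bottom, matching the index
  pair \<open>(i t, j t)\<close>, and \<open>p\<close> is the integer residue \<open>c - r\<close>. Row \<open>t\<close> of \<open>\<lambda>(I, J)\<close> then
  becomes the interval from \<open>i t\<close> to \<open>j t - 1\<close>, and the box below \<open>(t, p)\<close> is \<open>(t - 1, p - 1)\<close>.\<close>

definition shape_cell :: "nat \<Rightarrow> nat \<times> int \<Rightarrow> nat \<times> int" where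
  "shape_cell k = (\<lambda>(t, p). (k + 1 - t, p + int (k + 1 - t)))"

lemma bij_betw_shape_cell:
  "bij_betw (shape_cell k) (SIGMA t:{1..k}. {i t..<j t}) (shape_of k i j)"
proof (rule bij_betw_byWitness[where f' = "\<lambda>(r, c). (k + 1 - r, c - int r)"])
  show "(\<lambda>(r, c). (k + 1 - r, c - int r)) ` shape_of k i j \<subseteq> (SIGMA t:{1..k}. {i t..<j t})"
    by (auto simp: mem_shape_of)
qed (auto simp: shape_cell_def mem_shape_of)

lemma finite_shape_of: "finite (shape_of k i j)"
  using bij_betw_finite[OF bij_betw_shape_cell[of k i j]] by simp

lemma prod_shape_of:
  "(\<Prod>s\<in>shape_of k i j. g s) = (\<Prod>t\<in>{1..k}. \<Prod>p\<in>{i t..<j t}. g (shape_cell k (t, p)))"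
proof -
  have "(\<Prod>s\<in>shape_of k i j. g s) = (\<Prod>s\<in>(SIGMA t:{1..k}. {i t..<j t}). g (shape_cell k s))"
    by (rule prod.reindex_bij_betw[OF bij_betw_shape_cell, symmetric])
  also have "\<dots> = (\<Prod>t\<in>{1..k}. \<Prod>p\<in>{i t..<j t}. g (shape_cell k (t, p)))"
    by (subst prod.Sigma) auto
  finally show ?thesis .
qed

definition ssyt_upto :: "nat \<Rightarrow> (nat \<times> int) set \<Rightarrow> (nat \<times> int \<Rightarrow> nat) set" where
  "ssyt_upto m S = {T \<in> ssyt S. \<forall>s\<in>S. T s \<le> m}"

definition tableau_weight ::
    "nat \<Rightarrow> (nat \<Rightarrow> nat \<Rightarrow> real) \<Rightarrow> (nat \<times> int) set \<Rightarrow> (nat \<times> int \<Rightarrow> nat) \<Rightarrow> real" where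
  "tableau_weight n x S T = (\<Prod>(r, c)\<in>S. cyc n (x (T (r, c))) (c - int r))"

definition extend_filling ::
    "(nat \<times> int) set \<Rightarrow> (nat \<times> int) set \<Rightarrow> nat \<Rightarrow> (nat \<times> int \<Rightarrow> nat) \<Rightarrow> nat \<times> int \<Rightarrow> nat" where
  "extend_filling S S' m T = (\<lambda>s\<in>S'. if s \<in> S then T s else m)"

lemma finite_ssyt_upto: "finite S \<Longrightarrow> finite (ssyt_upto m S)"
  by (rule finite_subset[of _ "S \<rightarrow>\<^sub>E {1..m}"])
     (auto simp: ssyt_upto_def ssyt_def PiE_iff intro!: finite_PiE intro: extensional_arb)

lemma ssyt_row: "T \<in> ssyt S \<Longrightarrow> (r, c) \<in> S \<Longrightarrow> (r, c') \<in> S \<Longrightarrow> c \<le> c' \<Longrightarrow> T (r, c) \<le> T (r, c')"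
  unfolding ssyt_def by (cases "c = c'") (simp, blast intro: order.not_eq_order_implies_strict)

lemma ssyt_column: "T \<in> ssyt S \<Longrightarrow> (r, c) \<in> S \<Longrightarrow> (r', c) \<in> S \<Longrightarrow> r < r' \<Longrightarrow> T (r, c) < T (r', c)"
  unfolding ssyt_def by blast

lemma strict_mono_on_int_gap:
  fixes j :: "nat \<Rightarrow> int"
  assumes j: "strict_mono_on {1..k} j" and "1 \<le> a" "a \<le> b" "b \<le> k"
  shows "j a + int (b - a) \<le> j b"
  using assms(3,4)
proof (induction b rule: dec_induct)
  case (step b)
  have "j b < j (Suc b)"
    using step assms(2) by (intro strict_mono_onD[OF j]) auto
  then show ?case using step by (simp add: Suc_diff_le)
qed simp

text \<open>Filling the boxes outside \<open>\<lambda>(I, L)\<close> with the new largest entry can only violate strictness in a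
  column, and the interlacing condition prevents two such boxes in one column.\<close>

lemma extend_filling_in_ssyt_upto:
  assumes j: "strict_mono_on {1..k} j"
    and L: "\<And>t. t \<in> {1..k} \<Longrightarrow> L t \<in> interlacing_range i j t"
    and T: "T \<in> ssyt_upto m (shape_of k i L)"
  shows "extend_filling (shape_of k i L) (shape_of k i j) (Suc m) T
           \<in> ssyt_upto (Suc m) (shape_of k i j)"
proof -
  let ?S = "shape_of k i L" and ?S' = "shape_of k i j"
  let ?E = "extend_filling ?S ?S' (Suc m) T"
  have T_ssyt: "T \<in> ssyt ?S" and T_le: "\<And>s. s \<in> ?S \<Longrightarrow> T s \<le> m"
    using T by (auto simp: ssyt_upto_def)
  have T_pos: "T s \<ge> 1" if "s \<in> ?S" for s
    using T_ssyt that by (auto simp: ssyt_def PiE_iff)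
  have old: "?E s = T s" if "s \<in> ?S'" "s \<in> ?S" for s
    using that by (simp add: extend_filling_def)
  have new: "?E s = Suc m" if "s \<in> ?S'" "s \<notin> ?S" for s
    using that by (simp add: extend_filling_def)
  have le: "?E s \<le> Suc m" if "s \<in> ?S'" for s
    using that T_le[of s] old[of s] new[of s] by (cases "s \<in> ?S") auto
  have "?E \<in> ?S' \<rightarrow>\<^sub>E {1..}"
    using T_pos by (auto simp: extend_filling_def PiE_iff)
  moreover have "?E (r, c) \<le> ?E (r, c')" if c: "(r, c) \<in> ?S'" "(r, c') \<in> ?S'" "c < c'" for r c c'
  proof (cases "(r, c') \<in> ?S")
    case True
    then have "(r, c) \<in> ?S" using c by (auto simp: mem_shape_of)
    then show ?thesis using True c ssyt_row[OF T_ssyt, of r c c'] old by auto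
  next
    case False
    then show ?thesis using c le[of "(r, c)"] new by auto
  qed
  moreover have "?E (r, c) < ?E (r', c)" if c: "(r, c) \<in> ?S'" "(r', c) \<in> ?S'" "r < r'" for r r' c
  proof -
    define t where "t = k + 1 - r"
    define t' where "t' = k + 1 - r'"
    have t: "t \<in> {1..k}" "t' \<in> {1..k}" "t' < t" "int t - int t' = int r' - int r"
      using c by (auto simp: mem_shape_of t_def t'_def)
    \<comment> \<open>As \<open>(r, c)\<close> has a box of the shape below it, its residue is at most \<open>j (t - 1)\<close>, so it is
      an old box.\<close>
    have "j t' + int (t - 1 - t') \<le> j (t - 1)"
      using t by (intro strict_mono_on_int_gap[OF j]) auto
    moreover have "c - int r' < j t'"
      using c by (simp add: mem_shape_of t'_def)
    moreover have "j (t - 1) < L t"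
      using L[OF t(1)] t by (auto simp: interlacing_range_def)
    ultimately have "c - int r < L t" using t by (simp add: of_nat_diff)
    then have in_S: "(r, c) \<in> ?S" using c by (auto simp: mem_shape_of t_def)
    show ?thesis
    proof (cases "(r', c) \<in> ?S")
      case True
      then show ?thesis using in_S c ssyt_column[OF T_ssyt] old by auto
    next
      case False
      then show ?thesis using in_S c T_le[OF in_S] old new by auto
    qed
  qed
  ultimately show ?thesis
    using le by (auto simp: ssyt_upto_def ssyt_def)
qed

text \<open>Applied to a row of a tableau, where the entries at most \<open>m\<close> form an initial segment; the
  threshold is then the value of \<open>L\<close> for that row.\<close>

lemma downward_closed_threshold:
  fixes a b :: int
  assumes "a \<le> b" and down: "\<And>p q. a \<le> p \<Longrightarrow> p < q \<Longrightarrow> q < b \<Longrightarrow> P q \<Longrightarrow> P p"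
  shows "\<exists>l. a \<le> l \<and> l \<le> b \<and> (\<forall>p. a \<le> p \<longrightarrow> p < b \<longrightarrow> (P p \<longleftrightarrow> p < l))"
proof (cases "\<forall>p\<in>{a..<b}. P p")
  case True
  then show ?thesis using assms(1) by (intro exI[of _ b]) auto
next
  case False
  let ?M = "{p \<in> {a..<b}. \<not> P p}"
  have fin: "finite ?M" by (rule finite_subset[of _ "{a..<b}"]) auto
  have ne: "?M \<noteq> {}" using False by auto
  define l where "l = Min ?M"
  have l: "l \<in> ?M" unfolding l_def using Min_in[OF fin ne] .
  have "P p \<longleftrightarrow> p < l" if p: "a \<le> p" "p < b" for p
  proof
    assume "P p"
    show "p < l"
    proof (rule ccontr)
      assume "\<not> p < l"
      then show False using down[of l p] l p \<open>P p\<close> by (cases "p = l") auto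
    qed
  next
    assume "p < l"
    then show "P p" using Min_le[OF fin, of p] p by (auto simp: l_def)
  qed
  then show ?thesis using l by (intro exI[of _ l]) auto
qed

text \<open>Every tableau with entries at most \<open>m + 1\<close> arises exactly once: \<open>L\<close> is recovered as the right
  boundary of the entries at most \<open>m\<close>, and it interlaces with \<open>j\<close> because no column contains
  \<open>m + 1\<close> twice.\<close>

lemma bij_betw_extend_filling:
  assumes i: "strict_mono_on {1..k} i" and j: "strict_mono_on {1..k} j"
    and ij: "\<And>t. t \<in> {1..k} \<Longrightarrow> i t \<le> j t"
  shows "bij_betw (\<lambda>(L, T). extend_filling (shape_of k i L) (shape_of k i j) (Suc m) T)
    (SIGMA L:{L \<in> \<Pi>\<^sub>E t\<in>{1..k}. interlacing_range i j t. \<forall>t\<in>{1..k}. i t \<le> L t}.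
       ssyt_upto m (shape_of k i L))
    (ssyt_upto (Suc m) (shape_of k i j))"
  (is "bij_betw ?f (Sigma ?A ?B) ?C")
proof -
  let ?S' = "shape_of k i j"
  have bounds: "i t \<le> L t" "L t \<le> j t" if "L \<in> ?A" "t \<in> {1..k}" for L t
    using that by (auto simp: interlacing_range_def PiE_iff split: if_splits)
  have sub: "shape_of k i L \<subseteq> ?S'" if "L \<in> ?A" for L
  proof
    fix s assume s: "s \<in> shape_of k i L"
    obtain r c where rc: "s = (r, c)" by (cases s)
    have "k + 1 - r \<in> {1..k}" using s by (auto simp: rc mem_shape_of)
    then have "L (k + 1 - r) \<le> j (k + 1 - r)" by (rule bounds(2)[OF that])
    then show "s \<in> ?S'" using s by (auto simp: rc mem_shape_of)
  qed
  have old_iff: "?f (L, T) s \<le> m \<longleftrightarrow> s \<in> shape_of k i L"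
    if "L \<in> ?A" "T \<in> ?B L" "s \<in> ?S'" for L T s
    using that by (auto simp: extend_filling_def ssyt_upto_def)
  have L_eq: "L1 = L2"
    if L: "L1 \<in> ?A" "L2 \<in> ?A" and eq: "shape_of k i L1 = shape_of k i L2" for L1 L2
  proof (rule PiE_ext)
    show "L1 \<in> (\<Pi>\<^sub>E t\<in>{1..k}. interlacing_range i j t)" "L2 \<in> (\<Pi>\<^sub>E t\<in>{1..k}. interlacing_range i j t)"
      using L by auto
    fix t assume t: "t \<in> {1..k}"
    have mem: "shape_cell k (t, p) \<in> shape_of k i L \<longleftrightarrow> i t \<le> p \<and> p < L t" for p L
      using t by (auto simp: shape_cell_def mem_shape_of)
    have "i t \<le> p \<and> p < L1 t \<longleftrightarrow> i t \<le> p \<and> p < L2 t" for p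
      using mem[of p L1] mem[of p L2] eq by simp
    from this[of "L1 t"] this[of "L2 t"] show "L1 t = L2 t"
      using bounds(1)[OF L(1) t] bounds(1)[OF L(2) t] by linarith
  qed
  have "inj_on ?f (Sigma ?A ?B)"
  proof (rule inj_onI, clarify)
    fix L1 T1 L2 T2
    assume L1: "L1 \<in> (\<Pi>\<^sub>E t\<in>{1..k}. interlacing_range i j t)" "\<forall>t\<in>{1..k}. i t \<le> L1 t"
      and T1: "T1 \<in> ?B L1"
      and L2: "L2 \<in> (\<Pi>\<^sub>E t\<in>{1..k}. interlacing_range i j t)" "\<forall>t\<in>{1..k}. i t \<le> L2 t"
      and T2: "T2 \<in> ?B L2"
      and eq: "extend_filling (shape_of k i L1) ?S' (Suc m) T1
                 = extend_filling (shape_of k i L2) ?S' (Suc m) T2"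
    have A: "L1 \<in> ?A" "L2 \<in> ?A" using L1 L2 by auto
    have "s \<in> shape_of k i L1 \<longleftrightarrow> s \<in> shape_of k i L2" if "s \<in> ?S'" for s
      using old_iff[OF A(1) T1 that] old_iff[OF A(2) T2 that] eq by simp
    then have "shape_of k i L1 = shape_of k i L2"
      using sub[OF A(1)] sub[OF A(2)] by blast
    then have L: "L1 = L2" using L_eq A by blast
    have "T1 s = T2 s" if "s \<in> shape_of k i L1" for s
      using fun_cong[OF eq, of s] that sub[OF A(1)] L by (auto simp: extend_filling_def)
    then have "T1 = T2"
      using T1 T2 L
      by (intro PiE_ext[of T1 "shape_of k i L1" "\<lambda>_. {1..}" T2]) (auto simp: ssyt_upto_def ssyt_def)
    then show "L1 = L2 \<and> T1 = T2" using L by simp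
  qed
  moreover have "?f ` Sigma ?A ?B \<subseteq> ?C"
    by (auto intro!: extend_filling_in_ssyt_upto[OF j])
  moreover have "?C \<subseteq> ?f ` Sigma ?A ?B"
  proof
    fix T assume T: "T \<in> ?C"
    then have T_ssyt: "T \<in> ssyt ?S'" and T_le: "\<And>s. s \<in> ?S' \<Longrightarrow> T s \<le> Suc m"
      by (auto simp: ssyt_upto_def)
    have "\<exists>l. i t \<le> l \<and> l \<le> j t \<and> (\<forall>p. i t \<le> p \<longrightarrow> p < j t \<longrightarrow> (T (shape_cell k (t, p)) \<le> m \<longleftrightarrow> p < l))"
      if t: "t \<in> {1..k}" for t
    proof (rule downward_closed_threshold[OF ij[OF t]])
      fix p q assume "i t \<le> p" "p < q" "q < j t" "T (shape_cell k (t, q)) \<le> m"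
      moreover from this have "T (shape_cell k (t, p)) \<le> T (shape_cell k (t, q))"
        unfolding shape_cell_def case_prod_conv
        using t by (intro ssyt_row[OF T_ssyt]) (auto simp: mem_shape_of)
      ultimately show "T (shape_cell k (t, p)) \<le> m" by simp
    qed
    then obtain L0 where L0: "\<And>t. t \<in> {1..k} \<Longrightarrow> i t \<le> L0 t \<and> L0 t \<le> j t \<and>
        (\<forall>p. i t \<le> p \<longrightarrow> p < j t \<longrightarrow> (T (shape_cell k (t, p)) \<le> m \<longleftrightarrow> p < L0 t))"
      by metis
    define L where "L = restrict L0 {1..k}"
    have L: "i t \<le> L t" "L t \<le> j t" if "t \<in> {1..k}" for t
      using L0[OF that] that by (auto simp: L_def)
    have L_iff: "T (shape_cell k (t, p)) \<le> m \<longleftrightarrow> p < L t"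
      if "t \<in> {1..k}" "i t \<le> p" "p < j t" for t p
      using L0[OF that(1)] that by (auto simp: L_def)
    have S_iff: "T s \<le> m \<longleftrightarrow> s \<in> shape_of k i L" if "s \<in> ?S'" for s
    proof -
      obtain r c where s: "s = (r, c)" by (cases s)
      have t: "k + 1 - r \<in> {1..k}" "i (k + 1 - r) \<le> c - int r" "c - int r < j (k + 1 - r)"
        using that by (auto simp: s mem_shape_of)
      have "shape_cell k (k + 1 - r, c - int r) = (r, c)"
        using that by (auto simp: s shape_cell_def mem_shape_of)
      then have "T (r, c) \<le> m \<longleftrightarrow> c - int r < L (k + 1 - r)"
        using L_iff[OF t] by simp
      then show ?thesis using that by (auto simp: s mem_shape_of)
    qed
    have "L t \<in> interlacing_range i j t" if t: "t \<in> {1..k}" for t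
    proof (cases "t = 1")
      case True
      then show ?thesis using L[OF t] by (simp add: interlacing_range_def)
    next
      case False
      have "j (t - 1) < L t"
      proof (rule ccontr)
        assume "\<not> j (t - 1) < L t"
        \<comment> \<open>Otherwise the last box of row \<open>t - 1\<close> lies below a box with the largest entry.
          It exists because \<open>i (t - 1) < i t \<le> L t \<le> j (t - 1)\<close>.\<close>
        then have le: "L t \<le> j (t - 1)" by simp
        have mono: "i (t - 1) < i t" "j (t - 1) < j t"
          using t False by (auto intro!: strict_mono_onD[OF i] strict_mono_onD[OF j])
        define r where "r = k + 1 - t"
        define c where "c = j (t - 1) + int r"
        have r: "r \<in> {1..k}" "Suc r \<in> {1..k}" "k + 1 - r = t" "k + 1 - Suc r = t - 1"
          using t False by (auto simp: r_def)
        have up: "(r, c) \<in> ?S'"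
          using r mono le L[OF t] by (auto simp: mem_shape_of c_def)
        have down: "(Suc r, c) \<in> ?S'"
          using r mono le L[OF t] by (auto simp: mem_shape_of c_def)
        have "(r, c) \<notin> shape_of k i L"
          using r le by (auto simp: mem_shape_of c_def)
        then have "T (r, c) = Suc m" using S_iff[OF up] T_le[OF up] by linarith
        moreover have "T (r, c) < T (Suc r, c)"
          by (rule ssyt_column[OF T_ssyt up down]) simp
        ultimately show False using T_le[OF down] by simp
      qed
      then show ?thesis using False L[OF t] by (simp add: interlacing_range_def)
    qed
    then have A: "L \<in> ?A" using L by (auto simp: L_def)
    let ?T = "restrict T (shape_of k i L)"
    have S_sub: "shape_of k i L \<subseteq> ?S'" by (rule sub[OF A])
    have "?T \<in> ?B L"
      using T_ssyt S_sub S_iff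
      by (auto simp: ssyt_upto_def PiE_iff subset_iff ssyt_def)
    moreover have "?f (L, ?T) = T"
    proof
      fix s
      show "?f (L, ?T) s = T s"
      proof (cases "s \<in> ?S'")
        case True
        then show ?thesis using S_iff[OF True] T_le[OF True] by (auto simp: extend_filling_def)
      next
        case False
        have "T \<in> ?S' \<rightarrow>\<^sub>E {1..}" using T_ssyt by (simp add: ssyt_def)
        from PiE_arb[OF this False] show ?thesis using False by (simp add: extend_filling_def)
      qed
    qed
    ultimately show "T \<in> ?f ` Sigma ?A ?B" using A by (intro image_eqI[of _ _ "(L, ?T)"]) auto
  qed
  ultimately show ?thesis by (auto simp: bij_betw_def)
qed

text \<open>The new boxes of row \<open>t\<close> have the residues \<open>L t, \<dots>, j t - 1\<close>, which are the indices of the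
  factors of the curl entry \<open>(L t, j t)\<close>.\<close>

lemma tableau_weight_extend_filling:
  assumes "\<And>t. t \<in> {1..k} \<Longrightarrow> i t \<le> L t \<and> L t \<le> j t"
  shows "tableau_weight n x (shape_of k i j) (extend_filling (shape_of k i L) (shape_of k i j) m T)
    = (\<Prod>t\<in>{1..k}. curl n (x m) (L t) (j t)) * tableau_weight n x (shape_of k i L) T"
proof -
  let ?E = "extend_filling (shape_of k i L) (shape_of k i j) m T"
  let ?w = "\<lambda>T (r, c). cyc n (x (T (r, c))) (c - int r)"
  have "(\<Prod>p\<in>{i t..<j t}. ?w ?E (shape_cell k (t, p)))
      = curl n (x m) (L t) (j t) * (\<Prod>p\<in>{i t..<L t}. ?w T (shape_cell k (t, p)))"
    if t: "t \<in> {1..k}" for t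
  proof -
    have mem: "shape_cell k (t, p) \<in> shape_of k i M \<longleftrightarrow> i t \<le> p \<and> p < M t" for p M
      using t by (auto simp: shape_cell_def mem_shape_of)
    have E: "?w ?E (shape_cell k (t, p))
        = (if p < L t then ?w T (shape_cell k (t, p)) else cyc n (x m) p)"
      if "i t \<le> p" "p < j t" for p
      using that mem[of p j] mem[of p L] by (auto simp: extend_filling_def shape_cell_def)
    have "{i t..<j t} = {i t..<L t} \<union> {L t..<j t}" using assms[OF t] by auto
    then have "(\<Prod>p\<in>{i t..<j t}. ?w ?E (shape_cell k (t, p)))
        = (\<Prod>p\<in>{i t..<L t}. ?w ?E (shape_cell k (t, p))) * (\<Prod>p\<in>{L t..<j t}. ?w ?E (shape_cell k (t, p)))"
      by (simp add: prod.union_disjoint)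
    also have "(\<Prod>p\<in>{i t..<L t}. ?w ?E (shape_cell k (t, p))) = (\<Prod>p\<in>{i t..<L t}. ?w T (shape_cell k (t, p)))"
      using assms[OF t] by (intro prod.cong) (auto simp: E)
    also have "(\<Prod>p\<in>{L t..<j t}. ?w ?E (shape_cell k (t, p))) = (\<Prod>p\<in>{L t..<j t}. cyc n (x m) p)"
      using assms[OF t] by (intro prod.cong) (auto simp: E)
    also have "\<dots> = curl n (x m) (L t) (j t)"
      using assms[OF t] by (auto simp: curl_def)
    finally show ?thesis by simp
  qed
  then show ?thesis
    unfolding tableau_weight_def prod_shape_of prod.distrib[symmetric] by (intro prod.cong) auto
qed

text \<open>The case where some \<open>i t > j t\<close> is included since the Pieri rule produces column indices \<open>L\<close>
  that do not dominate \<open>i\<close>; their minors have to vanish for the two recursions to match.\<close>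

lemma det_curl_prod_eq_tableau_sum:
  assumes i: "strict_mono_on {1..k} i" and j: "strict_mono_on {1..k} j"
  shows "det (mat k k (\<lambda>(s, t). curl_prod n x m (i (s + 1)) (j (t + 1))))
    = (if \<forall>t\<in>{1..k}. i t \<le> j t
       then \<Sum>T\<in>ssyt_upto m (shape_of k i j). tableau_weight n x (shape_of k i j) T else 0)"
  using j
proof (induction m arbitrary: j)
  case 0
  have det: "det (mat k k (\<lambda>(s, t). curl_prod n x 0 (i (s + 1)) (j (t + 1))))
      = (if \<forall>t\<in>{1..k}. i t = j t then 1 else 0)"
    using det_zmat_one[OF i 0] by simp
  show ?case
  proof (cases "\<forall>t\<in>{1..k}. i t = j t")
    case True
    have "(r, c) \<notin> shape_of k i j" for r c
    proof
      assume "(r, c) \<in> shape_of k i j"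
      then have "k + 1 - r \<in> {1..k}" "i (k + 1 - r) < j (k + 1 - r)"
        by (auto simp: mem_shape_of)
      then show False using True by (metis less_irrefl)
    qed
    then have "shape_of k i j = {}" by auto
    then have "ssyt_upto 0 (shape_of k i j) = {\<lambda>_. undefined}"
      by (auto simp: ssyt_upto_def ssyt_def)
    then show ?thesis using True det \<open>shape_of k i j = {}\<close> by (simp add: tableau_weight_def)
  next
    case False
    have "ssyt_upto 0 (shape_of k i j) = {}" if le: "\<forall>t\<in>{1..k}. i t \<le> j t"
    proof -
      obtain t where t: "t \<in> {1..k}" "i t \<noteq> j t" using False by blast
      then have "shape_cell k (t, i t) \<in> shape_of k i j"
        using le by (force simp: shape_cell_def mem_shape_of)
      then show ?thesis by (force simp: ssyt_upto_def ssyt_def PiE_iff)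
    qed
    then show ?thesis using det False by simp
  qed
next
  case (Suc m)
  note j = Suc.prems
  let ?P = "\<Pi>\<^sub>E t\<in>{1..k}. interlacing_range i j t"
  let ?w = "\<lambda>L. \<Prod>t\<in>{1..k}. curl n (x (Suc m)) (L t) (j t)"
  let ?F = "\<lambda>L. \<Sum>T\<in>ssyt_upto m (shape_of k i L). tableau_weight n x (shape_of k i L) T"
  let ?A = "{L \<in> ?P. \<forall>t\<in>{1..k}. i t \<le> L t}"
  have L_le: "L t \<le> j t" if "L \<in> ?P" "t \<in> {1..k}" for L t
    using that by (auto simp: interlacing_range_def PiE_iff split: if_splits)
  have L_mono: "strict_mono_on {1..k} L" if L: "L \<in> ?P" for L
  proof (rule strict_mono_onI)
    fix a b assume ab: "a \<in> {1..k}" "b \<in> {1..k}" "a < b"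
    have "L a \<le> j a" using L_le[OF L ab(1)] .
    also have "j a \<le> j (b - 1)"
      using ab by (intro strict_mono_on_leD[OF j]) auto
    also have "\<dots> < L b" using PiE_mem[OF L ab(2)] ab by (auto simp: interlacing_range_def)
    finally show "L a < L b" .
  qed
  have fin: "finite ?P" by (intro finite_PiE) (auto simp: interlacing_range_def)
  have "det (mat k k (\<lambda>(s, t). curl_prod n x (Suc m) (i (s + 1)) (j (t + 1))))
      = (\<Sum>L\<in>?P. ?w L * (if \<forall>t\<in>{1..k}. i t \<le> L t then ?F L else 0))"
    unfolding det_curl_prod_Suc[OF i j] by (intro sum.cong refl) (simp only: Suc.IH[OF L_mono])
  also have "\<dots> = (\<Sum>L\<in>?A. ?w L * ?F L)"
    using fin by (intro sum.mono_neutral_cong_right) auto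
  finally have det: "det (mat k k (\<lambda>(s, t). curl_prod n x (Suc m) (i (s + 1)) (j (t + 1))))
      = (\<Sum>L\<in>?A. ?w L * ?F L)" .
  show ?case
  proof (cases "\<forall>t\<in>{1..k}. i t \<le> j t")
    case True
    have "(\<Sum>L\<in>?A. ?w L * ?F L)
        = (\<Sum>L\<in>?A. \<Sum>T\<in>ssyt_upto m (shape_of k i L). ?w L * tableau_weight n x (shape_of k i L) T)"
      by (simp add: sum_distrib_left)
    also have "\<dots> = (\<Sum>(L, T)\<in>(SIGMA L:?A. ssyt_upto m (shape_of k i L)).
        ?w L * tableau_weight n x (shape_of k i L) T)"
      using fin by (intro sum.Sigma) (auto intro!: finite_ssyt_upto finite_shape_of)
    also have "\<dots> = (\<Sum>(L, T)\<in>(SIGMA L:?A. ssyt_upto m (shape_of k i L)).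
        tableau_weight n x (shape_of k i j)
          (extend_filling (shape_of k i L) (shape_of k i j) (Suc m) T))"
      by (intro sum.cong refl, clarify)
         (rule tableau_weight_extend_filling[symmetric], use L_le in blast)
    also have "\<dots> = (\<Sum>T\<in>ssyt_upto (Suc m) (shape_of k i j). tableau_weight n x (shape_of k i j) T)"
      using sum.reindex_bij_betw[OF bij_betw_extend_filling[OF i j, of m],
          where g = "tableau_weight n x (shape_of k i j)"] True
      by (simp add: case_prod_unfold)
    finally show ?thesis using det True by simp
  next
    case False
    then obtain t where t: "t \<in> {1..k}" "j t < i t" by force
    then have "?A = {}" using L_le[OF _ t(1)] by force
    then show ?thesis using det False by (simp only: sum.empty if_False)
  qed
qed

section \<open>Single entries as sums over weakly increasing lists\<close>

definition sorted_lists :: "nat \<Rightarrow> nat \<Rightarrow> nat list set" where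
  "sorted_lists m r = {is. length is = r \<and> sorted is \<and> set is \<subseteq> {1..m}}"

definition list_weight :: "nat \<Rightarrow> (nat \<Rightarrow> nat \<Rightarrow> real) \<Rightarrow> int \<Rightarrow> nat list \<Rightarrow> real" where
  "list_weight n x k is = (\<Prod>p<length is. cyc n (x (is ! p)) (k + int p))"

lemma finite_sorted_lists: "finite (sorted_lists m r)"
  by (rule finite_subset[OF _ finite_lists_length_eq[of "{1..m}" r]]) (auto simp: sorted_lists_def)

text \<open>The last letter of a weakly increasing list is its largest, so it alone decides whether
  \<open>Suc m\<close> occurs.\<close>

lemma sorted_lists_Suc:
  "sorted_lists (Suc m) (Suc r) = sorted_lists m (Suc r) \<union> (\<lambda>is. is @ [Suc m]) ` sorted_lists (Suc m) r"
proof (intro equalityI subsetI)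
  fix xs assume xs: "xs \<in> sorted_lists (Suc m) (Suc r)"
  then obtain ys y where ys: "xs = ys @ [y]"
    by (cases xs rule: rev_cases) (auto simp: sorted_lists_def)
  show "xs \<in> sorted_lists m (Suc r) \<union> (\<lambda>is. is @ [Suc m]) ` sorted_lists (Suc m) r"
  proof (cases "y = Suc m")
    case True
    then show ?thesis using xs by (auto simp: sorted_lists_def ys sorted_append)
  next
    case False
    then have "y \<le> m" using xs by (auto simp: sorted_lists_def ys)
    then show ?thesis using xs by (force simp: sorted_lists_def ys sorted_append)
  qed
qed (force simp: sorted_lists_def sorted_append)+

text \<open>The two parts of \<open>sorted_lists_Suc\<close> are the two terms of \<open>curl_prod_Suc_recursion\<close>.\<close>

lemma curl_prod_eq_list_sum:
  "curl_prod n x m i (i + int r) = (\<Sum>is\<in>sorted_lists m r. list_weight n x i is)"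
proof (induction m arbitrary: r)
  case 0
  have "sorted_lists 0 r = (if r = 0 then {[]} else {})" by (auto simp: sorted_lists_def)
  then show ?case by (simp add: zmat_one_def list_weight_def)
next
  case (Suc m)
  note IH_m = Suc.IH
  show ?case
  proof (induction r)
    case 0
    have "curl_prod n x (Suc m) i i = curl_prod n x m i i"
      using curl_prod_Suc_recursion[of n x m i i] by (simp add: curl_prod_below_diagonal del: curl_prod.simps)
    moreover have "sorted_lists m 0 = {[]}" "sorted_lists (Suc m) 0 = {[]}"
      by (auto simp: sorted_lists_def)
    ultimately show ?case using IH_m[of 0] by (simp del: curl_prod.simps)
  next
    case (Suc r)
    have wt: "list_weight n x i (is @ [Suc m]) = cyc n (x (Suc m)) (i + int r) * list_weight n x i is"
      if "is \<in> sorted_lists (Suc m) r" for "is"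
      using that by (auto simp: list_weight_def sorted_lists_def nth_append)
    have "(\<Sum>is\<in>sorted_lists (Suc m) (Suc r). list_weight n x i is)
        = (\<Sum>is\<in>sorted_lists m (Suc r). list_weight n x i is)
          + (\<Sum>is\<in>(\<lambda>is. is @ [Suc m]) ` sorted_lists (Suc m) r. list_weight n x i is)"
      unfolding sorted_lists_Suc
      by (intro sum.union_disjoint) (auto simp: finite_sorted_lists, auto simp: sorted_lists_def)
    also have "(\<Sum>is\<in>(\<lambda>is. is @ [Suc m]) ` sorted_lists (Suc m) r. list_weight n x i is)
        = (\<Sum>is\<in>sorted_lists (Suc m) r. cyc n (x (Suc m)) (i + int r) * list_weight n x i is)"
      by (subst sum.reindex) (auto simp: inj_on_def wt)
    also have "\<dots> = cyc n (x (Suc m)) (i + int r) * curl_prod n x (Suc m) i (i + int r)"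
      unfolding Suc.IH by (simp add: sum_distrib_left)
    also have "(\<Sum>is\<in>sorted_lists m (Suc r). list_weight n x i is) = curl_prod n x m i (i + int (Suc r))"
      by (rule IH_m[symmetric])
    finally show ?case
      using curl_prod_Suc_recursion[of n x m i "i + int (Suc r)"]
      by (simp add: add.assoc del: curl_prod.simps)
  qed
qed

section \<open>Infinitely many variables\<close>

text \<open>For nonnegative terms one exhausting sequence of finite sets determines the unordered sum:
  every finite subset is contained in some \<open>B m\<close>.\<close>

lemma has_sum_exhaustion:
  fixes f :: "'a \<Rightarrow> real"
  assumes nonneg: "\<And>a. a \<in> A \<Longrightarrow> 0 \<le> f a" and "incseq B" and fin: "\<And>m. finite (B m)"
    and A: "(\<Union>m. B m) = A" and lim: "(\<lambda>m. sum f (B m)) \<longlonglongrightarrow> l"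
  shows "(f has_sum l) A"
proof -
  have sub: "B m \<subseteq> A" for m using A by blast
  then have f0: "0 \<le> f b" if "b \<in> B m" for b m using nonneg that by blast
  have "incseq (\<lambda>m. sum f (B m))"
    using \<open>incseq B\<close> fin f0 by (auto simp: incseq_def intro!: sum_mono2)
  then have le_l: "sum f (B m) \<le> l" for m by (rule incseq_le[OF _ lim])
  have sum_le: "sum f F \<le> l" if F: "finite F" "F \<subseteq> A" for F
  proof -
    have "\<exists>m. F \<subseteq> B m" using F
    proof (induction F)
      case (insert a F)
      then obtain m where "F \<subseteq> B m" by auto
      moreover obtain m' where "a \<in> B m'" using insert.prems A by blast
      ultimately have "insert a F \<subseteq> B (max m m')"
        using incseqD[OF \<open>incseq B\<close>, of m "max m m'"] incseqD[OF \<open>incseq B\<close>, of m' "max m m'"] by auto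
      then show ?case ..
    qed simp
    then obtain m where "F \<subseteq> B m" ..
    then have "sum f F \<le> sum f (B m)" using fin f0 by (intro sum_mono2) auto
    then show ?thesis using le_l[of m] by simp
  qed
  have summable: "f summable_on A"
    using nonneg by (rule nonneg_bdd_above_summable_on) (use sum_le in \<open>auto simp: bdd_above_def\<close>)
  have "infsum f A \<le> l" by (rule infsum_le_finite_sums[OF summable sum_le])
  moreover have "l \<le> infsum f A"
  proof (rule LIMSEQ_le_const2[OF lim])
    have "sum f (B m) \<le> infsum f A" for m
      using nonneg by (intro finite_sum_le_infsum[OF summable fin sub]) auto
    then show "\<exists>N. \<forall>m\<ge>N. sum f (B m) \<le> infsum f A" by blast
  qed
  ultimately have "infsum f A = l" by simp
  then show ?thesis using has_sum_infsum[OF summable] by simp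
qed

lemma cyc_index_in_range:
  assumes "n \<ge> 1"
  shows "nat ((k - 1) mod int n) + 1 \<in> {1..n}"
proof -
  have "nat ((k - 1) mod int n) < n"
    using assms by (simp add: nat_less_iff)
  then show ?thesis by simp
qed

lemma cyc_nonneg:
  assumes "n \<ge> 1" and "\<And>b. b \<in> {1..n} \<Longrightarrow> 0 \<le> a b"
  shows "0 \<le> cyc n a k"
  unfolding cyc_def using cyc_index_in_range[OF assms(1)] by (rule assms(2))

lemma list_weight_nonneg:
  assumes "n \<ge> 1" and "\<And>a b. a \<ge> 1 \<Longrightarrow> b \<in> {1..n} \<Longrightarrow> x a b \<ge> 0" and "set is \<subseteq> {1..}"
  shows "0 \<le> list_weight n x k is"
  unfolding list_weight_def
proof (rule prod_nonneg)
  fix p assume "p \<in> {..<length is}"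
  then have "is ! p \<in> {1..}" using assms(3) nth_mem[of p "is"] by blast
  then show "0 \<le> cyc n (x (is ! p)) (k + int p)"
    using assms(2) by (intro cyc_nonneg[OF assms(1)]) auto
qed

lemma tableau_weight_nonneg:
  assumes "n \<ge> 1" and "\<And>a b. a \<ge> 1 \<Longrightarrow> b \<in> {1..n} \<Longrightarrow> x a b \<ge> 0" and "T \<in> ssyt S"
  shows "0 \<le> tableau_weight n x S T"
  unfolding tableau_weight_def
proof (rule prod_nonneg, clarify)
  fix r c assume "(r, c) \<in> S"
  then have "T (r, c) \<ge> 1" using assms(3) by (auto simp: ssyt_def PiE_iff)
  then show "0 \<le> cyc n (x (T (r, c))) (c - int r)"
    using assms(2) by (intro cyc_nonneg[OF assms(1)]) auto
qed

text \<open>The truncations increase with \<open>m\<close>. An entry on the \<open>r\<close>-th superdiagonal is at most \<open>C ^ r\<close>,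
  where \<open>C\<close> is the sum of all variables: by the one-column recursion an entry
  at distance \<open>r + 1\<close> is a sum over \<open>q\<close> of one variable from \<open>x q\<close> times an entry at distance \<open>r\<close>.\<close>

lemma convergent_curl_prod:
  assumes n: "n \<ge> 1" and nonneg: "\<And>a b. a \<ge> 1 \<Longrightarrow> b \<in> {1..n} \<Longrightarrow> x a b \<ge> 0"
    and summable: "(\<lambda>(a, b). x a b) summable_on ({1..} \<times> {1..n})"
  shows "convergent (\<lambda>m. curl_prod n x m i (i + int r))"
proof -
  define C where "C = (\<Sum>\<^sub>\<infinity>(a, b)\<in>{1..} \<times> {1..n}. x a b)"
  have cyc0: "0 \<le> cyc n (x a) k" if "a \<ge> 1" for a k
    using cyc_nonneg[OF n] nonneg that by blast
  have col: "(\<Sum>q\<in>{1..m}. cyc n (x q) k) \<le> C" for m k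
  proof -
    define b where "b = nat ((k - 1) mod int n) + 1"
    have b: "b \<in> {1..n}" unfolding b_def by (rule cyc_index_in_range[OF n])
    have "(\<Sum>q\<in>{1..m}. cyc n (x q) k) = (\<Sum>(a, b)\<in>{1..m} \<times> {b}. x a b)"
      by (simp add: sum.cartesian_product[symmetric] cyc_def b_def)
    also have "\<dots> \<le> C"
      unfolding C_def using b nonneg by (intro finite_sum_le_infsum[OF summable]) auto
    finally show ?thesis .
  qed
  have C: "0 \<le> C" using col[of 0 0] by simp
  have Y0: "0 \<le> curl_prod n x m i (i + int r)" for m r
    unfolding curl_prod_eq_list_sum
    by (rule sum_nonneg, rule list_weight_nonneg[OF n nonneg]) (auto simp: sorted_lists_def)
  have bound: "curl_prod n x m i (i + int r) \<le> C ^ r" for m r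
  proof (induction r arbitrary: m)
    case 0
    have "curl_prod n x m i i = 1"
    proof (induction m)
      case (Suc m)
      then show ?case
        using curl_prod_Suc_recursion[of n x m i i] by (simp add: curl_prod_below_diagonal del: curl_prod.simps(2))
    qed (simp add: zmat_one_def)
    then show ?case by simp
  next
    case (Suc r)
    have "curl_prod n x m i (i + int (Suc r))
        = (\<Sum>q\<in>{1..m}. cyc n (x q) (i + int r) * curl_prod n x q i (i + int r))"
    proof (induction m)
      case 0
      show ?case by (simp add: zmat_one_def)
    next
      case (Suc m)
      then show ?case
        using curl_prod_Suc_recursion[of n x m i "i + int (Suc r)"]
        by (simp add: add.assoc del: curl_prod.simps)
    qed
    also have "\<dots> \<le> (\<Sum>q\<in>{1..m}. cyc n (x q) (i + int r) * C ^ r)"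
      using Suc.IH cyc0 by (intro sum_mono mult_left_mono) auto
    also have "\<dots> \<le> C * C ^ r"
      unfolding sum_distrib_right[symmetric] using col C by (intro mult_right_mono) auto
    finally show ?case by simp
  qed
  have "incseq (\<lambda>m. curl_prod n x m i (i + int r))"
  proof (rule incseq_SucI)
    fix m
    show "curl_prod n x m i (i + int r) \<le> curl_prod n x (Suc m) i (i + int r)"
    proof (cases r)
      case 0
      then show ?thesis
        using curl_prod_Suc_recursion[of n x m i i] by (simp add: curl_prod_below_diagonal del: curl_prod.simps)
    next
      case (Suc r')
      have "0 \<le> cyc n (x (Suc m)) (i + int r') * curl_prod n x (Suc m) i (i + int r')"
        using cyc0 Y0[of "Suc m" r'] by (intro mult_nonneg_nonneg) auto
      then show ?thesis
        using curl_prod_Suc_recursion[of n x m i "i + int r"] Suc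
        by (simp add: add.assoc del: curl_prod.simps)
    qed
  qed
  then show ?thesis
    using bound by (auto intro!: Bseq_mono_convergent BseqI'[where K = "C ^ r"] simp: Y0 incseq_def)
qed

lemma curl_prod_tendsto_loop_h:
  assumes n: "n \<ge> 1" and nonneg: "\<And>a b. a \<ge> 1 \<Longrightarrow> b \<in> {1..n} \<Longrightarrow> x a b \<ge> 0"
    and summable: "(\<lambda>(a, b). x a b) summable_on ({1..} \<times> {1..n})"
  shows "(\<lambda>m. curl_prod n x m i j) \<longlonglongrightarrow> loop_h n x i (j - i)"
proof (cases "j < i")
  case True
  then show ?thesis by (simp add: curl_prod_below_diagonal loop_h_def)
next
  case False
  define r where "r = nat (j - i)"
  have j: "j = i + int r" using False by (simp add: r_def)
  let ?A = "{is. length is = r \<and> sorted is \<and> set is \<subseteq> {1..}} :: nat list set"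
  obtain l where l: "(\<lambda>m. curl_prod n x m i j) \<longlonglongrightarrow> l"
    using convergent_curl_prod[OF assms] unfolding j convergent_def by blast
  have "(list_weight n x i has_sum l) ?A"
  proof (rule has_sum_exhaustion)
    show "0 \<le> list_weight n x i is" if "is \<in> ?A" for "is"
      using that by (intro list_weight_nonneg[OF n nonneg]) auto
    show "incseq (\<lambda>m. sorted_lists m r)"
      by (intro incseq_SucI) (auto simp: sorted_lists_def)
    show "(\<Union>m. sorted_lists m r) = ?A"
    proof (intro equalityI subsetI)
      fix xs assume "xs \<in> ?A"
      then have "xs \<in> sorted_lists (Max (set xs)) r" by (auto simp: sorted_lists_def)
      then show "xs \<in> (\<Union>m. sorted_lists m r)" by blast
    qed (auto simp: sorted_lists_def)
    show "(\<lambda>m. sum (list_weight n x i) (sorted_lists m r)) \<longlonglongrightarrow> l"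
      using l unfolding j curl_prod_eq_list_sum .
  qed (rule finite_sorted_lists)
  then have "infsum (list_weight n x i) ?A = l" by (rule infsumI)
  moreover have "loop_h n x i (j - i) = infsum (list_weight n x i) ?A"
    unfolding loop_h_def j by (auto simp: list_weight_def intro!: infsum_cong)
  ultimately show ?thesis using l by simp
qed

theorem theorem7p4:
  fixes n k :: nat
    and x :: "nat \<Rightarrow> nat \<Rightarrow> real"
    and i j :: "nat \<Rightarrow> int"
  assumes "n \<ge> 1"
    and "\<And>a b. a \<ge> 1 \<Longrightarrow> b \<in> {1..n} \<Longrightarrow> x a b \<ge> 0"
    and "(\<lambda>(a, b). x a b) summable_on ({1..} \<times> {1..n})"
    and "strict_mono_on {1..k} i"
    and "strict_mono_on {1..k} j"
    and "\<And>t. t \<in> {1..k} \<Longrightarrow> i t \<le> j t"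
  shows "minor (i ` {1..k}) (j ` {1..k}) (right_infinite_curl n x)
           = det (mat k k (\<lambda>(s, t). loop_h n x (i (s + 1)) (j (t + 1) - i (s + 1))))
       \<and> det (mat k k (\<lambda>(s, t). loop_h n x (i (s + 1)) (j (t + 1) - i (s + 1))))
           = loop_schur n x (shape_of k i j)"
proof
  let ?H = "det (mat k k (\<lambda>(s, t). loop_h n x (i (s + 1)) (j (t + 1) - i (s + 1))))"
  let ?S = "shape_of k i j"
  note tendsto = curl_prod_tendsto_loop_h[OF assms(1-3)]
  have "right_infinite_curl n x p q = loop_h n x p (q - p)" for p q
    unfolding right_infinite_curl_def by (rule limI[OF tendsto])
  then show "minor (i ` {1..k}) (j ` {1..k}) (right_infinite_curl n x) = ?H"
    unfolding minor_strict_mono_image[OF assms(4,5)] by simp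
  have "(\<lambda>m. det (mat k k (\<lambda>(s, t). curl_prod n x m (i (s + 1)) (j (t + 1))))) \<longlonglongrightarrow> ?H"
    by (rule tendsto_det_mat) (rule tendsto)
  moreover have "det (mat k k (\<lambda>(s, t). curl_prod n x m (i (s + 1)) (j (t + 1))))
      = (\<Sum>T\<in>ssyt_upto m ?S. tableau_weight n x ?S T)" for m
    unfolding det_curl_prod_eq_tableau_sum[OF assms(4,5)] using assms(6) by (intro if_P) blast
  ultimately have lim: "(\<lambda>m. \<Sum>T\<in>ssyt_upto m ?S. tableau_weight n x ?S T) \<longlonglongrightarrow> ?H"
    by simp
  have "(tableau_weight n x ?S has_sum ?H) (ssyt ?S)"
  proof (rule has_sum_exhaustion[OF _ _ _ _ lim])
    show "0 \<le> tableau_weight n x ?S T" if "T \<in> ssyt ?S" for T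
      using that by (intro tableau_weight_nonneg[OF assms(1,2)])
    show "incseq (\<lambda>m. ssyt_upto m ?S)"
      by (intro incseq_SucI) (auto simp: ssyt_upto_def intro: le_SucI)
    show "finite (ssyt_upto m ?S)" for m
      by (rule finite_ssyt_upto[OF finite_shape_of])
    show "(\<Union>m. ssyt_upto m ?S) = ssyt ?S"
    proof (intro equalityI subsetI)
      fix T assume "T \<in> ssyt ?S"
      then have "T \<in> ssyt_upto (Max (T ` ?S)) ?S"
        by (auto simp: ssyt_upto_def finite_shape_of)
      then show "T \<in> (\<Union>m. ssyt_upto m ?S)" by blast
    qed (auto simp: ssyt_upto_def)
  qed
  then have "infsum (tableau_weight n x ?S) (ssyt ?S) = ?H" by (rule infsumI)
  then show "?H = loop_schur n x ?S"
    by (simp only: loop_schur_def tableau_weight_def[symmetric])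
qed

end
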